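(* Let $S$ be a finitely generated positive cancelative commutative semigroup, let $E\subset S\setminus\{0\}$ be a nonempty finite subset, and let $P=P_S=\sum_{m\in S}t^m\in\hat R=\mathbb{Z}[[S]]$. Put $q=\prod_{e\in E}(1-t^e)\in R=\mathbb{Z}[S]$, which is a unit of $\hat R$, and let $p=q\cdot P\in\hat R$. Then: (1) $$P=\frac{-\sum_{m\in S}\tilde{\chi}(T_m)\,t^m}{\prod_{e\in E}(1-t^e)}.$$ (2) $$P=\frac{N_Q-\sum_{J\subset E,\ \#J\ge 2}(-1)^{\#J}N_{D^J}}{\prod_{e\in E}(1-t^e)}.$$ (3) If $E$ generates the cone $C(S)$, then $p=\prod_{e\in E}(1-t^e)\cdot P\in R$. (4) If $q',p'$ are elements of $R$ such that $q'\cdot P=p'$, then $p\cdot q'=p'\cdot q$.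
   Context: Semigroups: a semigroup here is a set with an associative operation $+$ and a neutral element $0$. It is cancelative if $m+n=m'+n$ implies $m=m'$; positive if $m+n=0$ implies $m=n=0$; finitely generated if finitely many elements generate it under linear combinations with nonnegative integer coefficients. $S$ is viewed inside the abelian group $G(S)$ it generates (classes of pairs $(m,n)$ with $(m,n)\sim(m',n')$ iff $m+n'=m'+n$); differences $m-n$ are taken in $G(S)$ (which may have torsion). $C(S)$ is the convex cone in the $\mathbb{Q}$-vector space $G(S)\otimes_{\mathbb{Z}}\mathbb{Q}$ generated by the elements $m\otimes 1$, $m\in S$; "$E$ generates the cone $C(S)$" means that every element of $C(S)$ is a nonnegative rational combination of the elements $e\otimes 1$, $e\in E$. Rings: $R=\mathbb{Z}[S]$ is the ring of finite sums $\sum_{m\in S}a_mt^m$, $a_m\in\mathbb{Z}$, with $t^m t^n=t^{m+n}$. $\hat R=\mathbb{Z}[[S]]$ is the ring of all formal sums $\sum_{m\in S}a_mt^m$, $a_m\in\mathbb{Z}$, with the same multiplication rule (well defined because each $m\in S$ can be written as $m=n+n'$ with $n,n'\in S$ in only finitely many ways). For $e\in S\setminus\{0\}$, $1-t^e$ is a unit in $\hat R$ with inverse $\sum_{i\ge0}t^{ie}$; fractions with denominator $\prod_{e\in E}(1-t^e)$ mean multiplication by the inverse in $\hat R$. Combinatorial data attached to $E$: for $J\subset E$ let $e_J=\sum_{e\in J}e$ (with $e_\emptyset=0$). For $m\in S$, $T_m=\{J\subset E\mid m-e_J\in S\}$, an abstract simplicial complex (containing the empty face), with reduced Euler characteristic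 $\tilde\chi(T_m)=\sum_{J\in T_m}(-1)^{\#J-1}$. Also $\mathrm{supp}(m)=\{e\in E\mid m-e\in S\}$, $Q=\{m\in S\mid m-e\notin S\text{ for all }e\in E\}$, and for $J\subset E$ with $\#J\ge2$, $D^J=\{m\in S\mid J\subset\mathrm{supp}(m)\text{ and }m-e_J\notin S\}$. For a subset $B\subset S$, $N_B=\sum_{m\in B}t^m\in\hat R$. *)

theory Defs
  imports Complex_Main "HOL-Library.Poly_Mapping"
begin

section \<open>Semigroups\<close>

text \<open>The semigroup \<open>S\<close> is the whole type \<open>'a\<close>.  The library class
  \<^class>\<open>cancel_comm_monoid_add\<close> is avoided because it carries an extra subtraction on
  \<open>S\<close>; differences are taken in the group generated by \<open>S\<close> instead.\<close>

class cancelative_semigroup = comm_monoid_add +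
  assumes cancelative: "m + n = m' + n \<Longrightarrow> m = m'"

class fg_positive_cancelative_semigroup = cancelative_semigroup +
  assumes positive: "m + n = 0 \<Longrightarrow> m = 0 \<and> n = 0"
    and finitely_generated:
      "\<exists>A. finite A \<and> (\<forall>m. \<exists>c :: 'a \<Rightarrow> nat. m = (\<Sum>a\<in>A. \<Sum>i<c a. a))"


section \<open>The group generated by a cancelative semigroup\<close>

definition difference_rel :: "'a::cancelative_semigroup \<times> 'a \<Rightarrow> 'a \<times> 'a \<Rightarrow> bool" where
  "difference_rel x y \<longleftrightarrow> fst x + snd y = fst y + snd x"

lemma equivp_difference_rel:
  "equivp (difference_rel :: 'a::cancelative_semigroup \<times> 'a \<Rightarrow> 'a \<times> 'a \<Rightarrow> bool)"
proof (rule equivpI)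
  show "reflp (difference_rel :: 'a \<times> 'a \<Rightarrow> _)"
    by (simp add: reflp_def difference_rel_def)
  show "symp (difference_rel :: 'a \<times> 'a \<Rightarrow> _)"
    by (simp add: symp_def difference_rel_def)
  show "transp (difference_rel :: 'a \<times> 'a \<Rightarrow> _)"
  proof (rule transpI)
    fix x y z :: "'a \<times> 'a"
    assume xy: "difference_rel x y" and yz: "difference_rel y z"
    have "(fst x + snd z) + snd y = (fst x + snd y) + snd z"
      by (simp add: ac_simps)
    also have "\<dots> = (fst y + snd z) + snd x"
      using xy by (simp add: difference_rel_def ac_simps)
    also have "\<dots> = (fst z + snd x) + snd y"
      using yz by (simp add: difference_rel_def ac_simps)
    finally show "difference_rel x z"
      unfolding difference_rel_def by (rule cancelative)
  qed
qed

quotient_type (overloaded) 'a generated_group = "'a::cancelative_semigroup \<times> 'a" / difference_rel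
  by (fact equivp_difference_rel)

instantiation generated_group :: (cancelative_semigroup) ab_group_add
begin

lift_definition zero_generated_group :: "'a generated_group" is "(0, 0)" .

lift_definition plus_generated_group ::
  "'a generated_group \<Rightarrow> 'a generated_group \<Rightarrow> 'a generated_group"
  is "\<lambda>x y. (fst x + fst y, snd x + snd y)"
proof -
  fix x x' y y' :: "'a \<times> 'a"
  assume "difference_rel x x'" "difference_rel y y'"
  then have "(fst x + snd x') + (fst y + snd y') = (fst x' + snd x) + (fst y' + snd y)"
    by (simp add: difference_rel_def)
  then show "difference_rel (fst x + fst y, snd x + snd y) (fst x' + fst y', snd x' + snd y')"
    by (simp add: difference_rel_def ac_simps)
qed

lift_definition uminus_generated_group :: "'a generated_group \<Rightarrow> 'a generated_group"
  is "\<lambda>x. (snd x, fst x)"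
  by (simp add: difference_rel_def ac_simps)

definition minus_generated_group ::
  "'a generated_group \<Rightarrow> 'a generated_group \<Rightarrow> 'a generated_group" where
  "minus_generated_group x y = x + - y"

instance
proof
  fix a b c :: "'a generated_group"
  show "a + b + c = a + (b + c)"
    by transfer (simp add: difference_rel_def ac_simps)
  show "a + b = b + a"
    by transfer (simp add: difference_rel_def ac_simps)
  show "0 + a = a"
    by transfer (simp add: difference_rel_def ac_simps)
  show "- a + a = 0"
    by transfer (simp add: difference_rel_def ac_simps)
  show "a - b = a + - b"
    by (rule minus_generated_group_def)
qed

end

text \<open>The inclusion of \<open>S\<close> into the group it generates; \<open>m - n \<in> S\<close> is rendered as
  \<open>of_semigroup m - of_semigroup n \<in> range of_semigroup\<close>.\<close>

lift_definition of_semigroup :: "'a::cancelative_semigroup \<Rightarrow> 'a generated_group"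
  is "\<lambda>m. (m, 0)" .

lemma of_semigroup_add: "of_semigroup (m + n) = of_semigroup m + of_semigroup n"
  by transfer (simp add: difference_rel_def)

lemma inj_of_semigroup: "inj of_semigroup"
  by (rule injI, transfer) (simp add: difference_rel_def)


section \<open>Tensor products over the integers and the cone of a semigroup\<close>

text \<open>The free abelian group on \<open>G \<times> H\<close> modulo the subgroup generated by the bilinearity
  relations.\<close>

inductive_set bilinearity_relations ::
  "(('g::ab_group_add \<times> 'h::ab_group_add) \<Rightarrow>\<^sub>0 int) set" where
  zero: "0 \<in> bilinearity_relations"
| diff: "x \<in> bilinearity_relations \<Longrightarrow> y \<in> bilinearity_relations
    \<Longrightarrow> x - y \<in> bilinearity_relations"
| left: "frag_of (g + g', h) - frag_of (g, h) - frag_of (g', h) \<in> bilinearity_relations"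
| right: "frag_of (g, h + h') - frag_of (g, h) - frag_of (g, h') \<in> bilinearity_relations"

lemma bilinearity_relations_uminus:
  "x \<in> bilinearity_relations \<Longrightarrow> - x \<in> bilinearity_relations"
  using bilinearity_relations.diff[OF bilinearity_relations.zero, of x] by simp

lemma bilinearity_relations_add:
  "x \<in> bilinearity_relations \<Longrightarrow> y \<in> bilinearity_relations \<Longrightarrow> x + y \<in> bilinearity_relations"
  using bilinearity_relations.diff[of x "- y"] bilinearity_relations_uminus[of y] by simp

definition tensor_rel ::
  "(('g::ab_group_add \<times> 'h::ab_group_add) \<Rightarrow>\<^sub>0 int) \<Rightarrow> (('g \<times> 'h) \<Rightarrow>\<^sub>0 int) \<Rightarrow> bool" where
  "tensor_rel x y \<longleftrightarrow> x - y \<in> bilinearity_relations"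

lemma equivp_tensor_rel:
  "equivp (tensor_rel :: (('a::ab_group_add \<times> 'b::ab_group_add) \<Rightarrow>\<^sub>0 int) \<Rightarrow> _)"
proof (rule equivpI)
  show "reflp (tensor_rel :: (('a \<times> 'b) \<Rightarrow>\<^sub>0 int) \<Rightarrow> _)"
    by (simp add: reflp_def tensor_rel_def bilinearity_relations.zero)
  show "symp (tensor_rel :: (('a \<times> 'b) \<Rightarrow>\<^sub>0 int) \<Rightarrow> _)"
    unfolding tensor_rel_def by (rule sympI) (metis bilinearity_relations_uminus minus_diff_eq)
  show "transp (tensor_rel :: (('a \<times> 'b) \<Rightarrow>\<^sub>0 int) \<Rightarrow> _)"
  proof (rule transpI)
    fix x y z :: "('a \<times> 'b) \<Rightarrow>\<^sub>0 int"
    assume "tensor_rel x y" "tensor_rel y z"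
    then have "(x - y) + (y - z) \<in> bilinearity_relations"
      unfolding tensor_rel_def by (rule bilinearity_relations_add)
    then show "tensor_rel x z" by (simp add: tensor_rel_def)
  qed
qed

quotient_type (overloaded) ('g, 'h) tensor =
  "('g::ab_group_add \<times> 'h::ab_group_add) \<Rightarrow>\<^sub>0 int" / tensor_rel
  by (fact equivp_tensor_rel)

instantiation tensor :: (ab_group_add, ab_group_add) ab_group_add
begin

lift_definition zero_tensor :: "('a, 'b) tensor" is 0 .

lift_definition plus_tensor :: "('a, 'b) tensor \<Rightarrow> ('a, 'b) tensor \<Rightarrow> ('a, 'b) tensor" is "(+)"
  unfolding tensor_rel_def by (metis add_diff_add bilinearity_relations_add)

lift_definition uminus_tensor :: "('a, 'b) tensor \<Rightarrow> ('a, 'b) tensor" is uminus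
  unfolding tensor_rel_def by (metis bilinearity_relations_uminus minus_diff_minus)

definition minus_tensor :: "('a, 'b) tensor \<Rightarrow> ('a, 'b) tensor \<Rightarrow> ('a, 'b) tensor" where
  "minus_tensor x y = x + - y"

instance
proof
  fix a b c :: "('a, 'b) tensor"
  show "a + b + c = a + (b + c)"
    by transfer (simp add: tensor_rel_def bilinearity_relations.zero ac_simps)
  show "a + b = b + a"
    by transfer (simp add: tensor_rel_def bilinearity_relations.zero ac_simps)
  show "0 + a = a"
    by transfer (simp add: tensor_rel_def bilinearity_relations.zero)
  show "- a + a = 0"
    by transfer (simp add: tensor_rel_def bilinearity_relations.zero)
  show "a - b = a + - b"
    by (rule minus_tensor_def)
qed

end

lift_definition pure_tensor :: "'g::ab_group_add \<Rightarrow> 'h::ab_group_add \<Rightarrow> ('g, 'h) tensor"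
  is "\<lambda>g h. frag_of (g, h)" .

lemma pure_tensor_add_left: "pure_tensor (g + g') h = pure_tensor g h + pure_tensor g' h"
  by transfer (simp add: tensor_rel_def bilinearity_relations.left flip: diff_diff_eq)

lemma pure_tensor_add_right: "pure_tensor g (h + h') = pure_tensor g h + pure_tensor g h'"
  by transfer (simp add: tensor_rel_def bilinearity_relations.right flip: diff_diff_eq)

lemma tensor_induct [case_names zero diff pure]:
  assumes "P 0" and "\<And>x y. P x \<Longrightarrow> P y \<Longrightarrow> P (x - y)" and "\<And>g h. P (pure_tensor g h)"
  shows "P (x :: ('g::ab_group_add, 'h::ab_group_add) tensor)"
proof -
  have "P (abs_tensor y)" for y :: "('g \<times> 'h) \<Rightarrow>\<^sub>0 int"
    using subset_UNIV[of "Poly_Mapping.keys y"]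
  proof (induction y rule: frag_induction)
    case zero
    show ?case using assms(1) by (simp add: zero_tensor_def)
  next
    case (one x)
    show ?case using assms(3)[of "fst x" "snd x"] by (simp add: pure_tensor.abs_eq)
  next
    case (diff a b)
    then show ?case using assms(2)[of "abs_tensor a" "abs_tensor b"]
      by (simp add: minus_tensor_def uminus_tensor.abs_eq plus_tensor.abs_eq)
  qed
  then show ?thesis
    by (metis Quotient_abs_rep Quotient_tensor)
qed

text \<open>The rational vector space structure on the tensor product of a group with the
  rationals: \<open>c\<close> times \<open>g \<otimes> q\<close> is \<open>g \<otimes> c q\<close>.\<close>

lift_definition scale_rat ::
  "rat \<Rightarrow> ('g::ab_group_add, rat) tensor \<Rightarrow> ('g, rat) tensor"
  is "\<lambda>c. frag_extend (\<lambda>(g, q). frag_of (g, c * q))"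
proof -
  fix c :: rat and x y :: "('g \<times> rat) \<Rightarrow>\<^sub>0 int"
  let ?f = "frag_extend (\<lambda>(g :: 'g, q). frag_of (g, c * q))"
  have "?f z \<in> bilinearity_relations" if "z \<in> bilinearity_relations" for z
    using that
    by induction
      (auto simp: frag_extend_diff distrib_left intro: bilinearity_relations.intros)
  then show "tensor_rel x y \<Longrightarrow> tensor_rel (?f x) (?f y)"
    unfolding tensor_rel_def by (metis frag_extend_diff)
qed

lemma scale_rat_pure: "scale_rat c (pure_tensor g q) = pure_tensor g (c * q)"
  by transfer (simp add: tensor_rel_def bilinearity_relations.zero)

lemma scale_rat_add: "scale_rat c (x + y) = scale_rat c x + scale_rat c y"
  by transfer (simp add: tensor_rel_def bilinearity_relations.zero frag_extend_add)

lemma scale_rat_diff: "scale_rat c (x - y) = scale_rat c x - scale_rat c y"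
  using scale_rat_add[of c "x - y" y] by (simp add: algebra_simps)

lemma scale_rat_zero: "scale_rat c 0 = 0"
  using scale_rat_diff[of c 0 0] by simp

lemma vector_space_scale_rat: "vector_space scale_rat"
proof
  fix a b :: rat and x y :: "('g::ab_group_add, rat) tensor"
  show "scale_rat a (x + y) = scale_rat a x + scale_rat a y"
    by (rule scale_rat_add)
  show "scale_rat (a + b) x = scale_rat a x + scale_rat b x"
    by (induction x rule: tensor_induct)
      (simp_all add: scale_rat_zero scale_rat_diff scale_rat_pure distrib_right
        pure_tensor_add_right)
  show "scale_rat a (scale_rat b x) = scale_rat (a * b) x"
    by (induction x rule: tensor_induct)
      (simp_all add: scale_rat_zero scale_rat_diff scale_rat_pure mult.assoc)
  show "scale_rat 1 x = x"
    by (induction x rule: tensor_induct)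
      (simp_all add: scale_rat_zero scale_rat_diff scale_rat_pure)
qed

definition rational_cone :: "('g::ab_group_add, rat) tensor set \<Rightarrow> ('g, rat) tensor set" where
  "rational_cone X =
     {\<Sum>x\<in>F. scale_rat (c x) x | F c. finite F \<and> F \<subseteq> X \<and> (\<forall>x\<in>F. 0 \<le> c x)}"

definition to_cone :: "'a::cancelative_semigroup \<Rightarrow> ('a generated_group, rat) tensor" where
  "to_cone m = pure_tensor (of_semigroup m) 1"

definition semigroup_cone :: "('a::cancelative_semigroup generated_group, rat) tensor set" where
  "semigroup_cone = rational_cone (range to_cone)"

definition generates_cone :: "'a::cancelative_semigroup set \<Rightarrow> bool" where
  "generates_cone E \<longleftrightarrow> semigroup_cone \<subseteq> rational_cone (to_cone ` E)"


section \<open>Formal sums over a semigroup\<close>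

lemma mono_subseq_nat:
  fixes f :: "nat \<Rightarrow> nat"
  shows "\<exists>r :: nat \<Rightarrow> nat. strict_mono r \<and> mono (f \<circ> r)"
proof -
  obtain r :: "nat \<Rightarrow> nat" where r: "strict_mono r" "monoseq (f \<circ> r)"
    using seq_monosub[of f] by (auto simp: comp_def)
  show ?thesis
  proof (cases "incseq (f \<circ> r)")
    case True
    then show ?thesis using r by blast
  next
    case False
    then have dec: "decseq (f \<circ> r)"
      using r(2) by (simp add: monoseq_iff)
    define k where "k = (LEAST v. v \<in> range (f \<circ> r))"
    have "k \<in> range (f \<circ> r)"
      unfolding k_def by (rule LeastI[of _ "(f \<circ> r) 0"]) blast
    then obtain n where n: "k = (f \<circ> r) n" by blast
    have "(f \<circ> r) (i + n) = k" for i
    proof (rule antisym)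
      show "(f \<circ> r) (i + n) \<le> k"
        unfolding n using dec by (rule decseqD) simp
      show "k \<le> (f \<circ> r) (i + n)"
        unfolding k_def by (rule Least_le) blast
    qed
    then have "mono (f \<circ> (\<lambda>i. r (i + n)))"
      by (simp add: mono_def comp_def)
    moreover have "strict_mono (\<lambda>i. r (i + n))"
      using r(1) by (simp add: strict_mono_def)
    ultimately show ?thesis by blast
  qed
qed

lemma mono_subseq_pointwise:
  fixes f :: "nat \<Rightarrow> 'b \<Rightarrow> nat"
  assumes "finite A"
  shows "\<exists>r :: nat \<Rightarrow> nat. strict_mono r \<and> (\<forall>a\<in>A. mono (\<lambda>i. f (r i) a))"
  using assms
proof induction
  case empty
  show ?case by (rule exI[of _ id]) (simp add: strict_mono_def)
next
  case (insert x A)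
  then obtain r :: "nat \<Rightarrow> nat" where r: "strict_mono r" "\<forall>a\<in>A. mono (\<lambda>i. f (r i) a)" by blast
  obtain s :: "nat \<Rightarrow> nat" where s: "strict_mono s" "mono ((\<lambda>i. f (r i) x) \<circ> s)"
    using mono_subseq_nat by blast
  have "strict_mono (r \<circ> s)"
    using r(1) s(1) by (rule strict_mono_o)
  moreover have "\<forall>a\<in>insert x A. mono (\<lambda>i. f ((r \<circ> s) i) a)"
    using r(2) s strict_mono_mono[OF s(1)] by (auto simp: mono_def)
  ultimately show ?case by blast
qed

context fg_positive_cancelative_semigroup
begin

lemma nat_combination_add:
  fixes c d :: "'a \<Rightarrow> nat"
  shows "(\<Sum>a\<in>A. \<Sum>i<c a + d a. a) = (\<Sum>a\<in>A. \<Sum>i<c a. a) + (\<Sum>a\<in>A. \<Sum>i<d a. a)"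
proof -
  have "(\<Sum>i<k + l. a) = (\<Sum>i<k. a) + (\<Sum>i<l. a)" for k l :: nat and a :: 'a
    by (induction l) (simp_all add: ac_simps)
  then show ?thesis by (simp add: sum.distrib)
qed

lemma sum_eq_0_positive:
  "finite A \<Longrightarrow> (\<Sum>a\<in>A. f a) = 0 \<Longrightarrow> \<forall>a\<in>A. f a = 0"
  by (induction A rule: finite_induct) (auto dest: positive)

lemma finite_representations:
  assumes "finite A" "0 \<notin> A"
  shows "finite {c. (\<forall>a. a \<notin> A \<longrightarrow> c a = (0::nat)) \<and> (\<Sum>a\<in>A. \<Sum>i<c a. a) = m}"
    (is "finite ?R")
proof (rule ccontr)
  assume "infinite ?R"
  then obtain f :: "nat \<Rightarrow> 'a \<Rightarrow> nat" where f: "inj f" "range f \<subseteq> ?R"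
    using infinite_countable_subset by blast
  obtain r :: "nat \<Rightarrow> nat" where r: "strict_mono r" "\<forall>a\<in>A. mono (\<lambda>i. f (r i) a)"
    using mono_subseq_pointwise[OF assms(1)] by blast
  define c d where "c = f (r 0)" and "d = f (r 1)"
  have le: "c a \<le> d a" if "a \<in> A" for a
    using r(2) that unfolding c_def d_def by (auto simp: mono_def)
  have c: "\<And>a. a \<notin> A \<Longrightarrow> c a = 0" "(\<Sum>a\<in>A. \<Sum>i<c a. a) = m"
    and d: "\<And>a. a \<notin> A \<Longrightarrow> d a = 0" "(\<Sum>a\<in>A. \<Sum>i<d a. a) = m"
    using f(2) unfolding c_def d_def by blast+
  have "(\<Sum>a\<in>A. \<Sum>i<d a. a) = (\<Sum>a\<in>A. \<Sum>i<(d a - c a) + c a. a)"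
    using le by (intro sum.cong) auto
  then have "(\<Sum>a\<in>A. \<Sum>i<d a - c a. a) + m = 0 + m"
    using c(2) d(2) nat_combination_add[of "\<lambda>a. d a - c a" c A] by simp
  then have "(\<Sum>a\<in>A. \<Sum>i<d a - c a. a) = 0"
    by (rule cancelative)
  then have z: "(\<Sum>i<d a - c a. a) = 0" if "a \<in> A" for a
    using sum_eq_0_positive[OF assms(1), of "\<lambda>a. \<Sum>i<d a - c a. a"] that by blast
  have "d a - c a = 0" if "a \<in> A" for a
  proof (rule ccontr)
    assume "d a - c a \<noteq> 0"
    then obtain k where "d a - c a = Suc k"
      using not0_implies_Suc by blast
    then have "(\<Sum>i<k. a) + a = 0"
      using z[OF that] by simp
    then show False
      using positive assms(2) that by blast
  qed
  then have "c = d"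
    using le c(1) d(1) by (intro ext) (metis diff_is_0_eq le_antisym)
  then have "r 0 = r 1"
    using f(1) unfolding c_def d_def by (simp add: inj_eq)
  then show False
    using r(1) by (metis strict_mono_eq zero_neq_one)
qed

lemma finite_decompositions: "finite {(n, n'). n + n' = m}"
proof -
  obtain A0 where A0: "finite A0" "\<And>m. \<exists>c :: 'a \<Rightarrow> nat. m = (\<Sum>a\<in>A0. \<Sum>i<c a. a)"
    using finitely_generated by blast
  define A where "A = A0 - {0}"
  have A: "finite A" "0 \<notin> A"
    using A0(1) by (auto simp: A_def)
  define v where "v c = (\<Sum>a\<in>A. \<Sum>i<c a. a)" for c :: "'a \<Rightarrow> nat"
  define R where "R = {c. (\<forall>a. a \<notin> A \<longrightarrow> c a = 0) \<and> v c = m}"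
  have rep: "\<exists>c. (\<forall>a. a \<notin> A \<longrightarrow> c a = 0) \<and> v c = n" for n
  proof -
    obtain c :: "'a \<Rightarrow> nat" where c: "n = (\<Sum>a\<in>A0. \<Sum>i<c a. a)"
      using A0(2) by blast
    have "n = (\<Sum>a\<in>A. \<Sum>i<c a. a)"
      unfolding c A_def using A0(1) by (intro sum.mono_neutral_right) auto
    also have "\<dots> = v (\<lambda>a. if a \<in> A then c a else 0)"
      unfolding v_def by (intro sum.cong) auto
    finally show ?thesis
      by (intro exI[of _ "\<lambda>a. if a \<in> A then c a else 0"]) auto
  qed
  have finR: "finite R"
    unfolding R_def v_def using A by (rule finite_representations)
  have fin: "finite {c. \<forall>a. c a \<le> e a}" if "e \<in> R" for e
  proof -
    have "{c. \<forall>a. c a \<le> e a} \<subseteq> {c. \<forall>a. (a \<in> A \<longrightarrow> c a \<in> {..Max (e ` A)}) \<and> (a \<notin> A \<longrightarrow> c a = 0)}"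
    proof (intro subsetI CollectI allI conjI impI)
      fix c a assume c: "c \<in> {c. \<forall>a. c a \<le> e a}"
      then have le: "c a \<le> e a" by simp
      show "c a \<in> {..Max (e ` A)}" if "a \<in> A"
      proof -
        have "e a \<le> Max (e ` A)" using A(1) that by (intro Max_ge) auto
        then show ?thesis using le by simp
      qed
      show "c a = 0" if "a \<notin> A"
        using le that \<open>e \<in> R\<close> by (simp add: R_def)
    qed
    moreover have "finite \<dots>"
      using A(1) by (intro finite_set_of_finite_funs) auto
    ultimately show ?thesis by (rule finite_subset)
  qed
  let ?B = "v ` (\<Union>e\<in>R. {c. \<forall>a. c a \<le> e a})"
  have "{(n, n'). n + n' = m} \<subseteq> ?B \<times> ?B"
  proof clarify
    fix n n' assume m: "m = n + n'"
    obtain c c' where c: "\<forall>a. a \<notin> A \<longrightarrow> c a = 0" "v c = n"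
      and c': "\<forall>a. a \<notin> A \<longrightarrow> c' a = 0" "v c' = n'"
      using rep by meson
    have "(\<lambda>a. c a + c' a) \<in> R"
      using c c' nat_combination_add[of c c' A] by (simp add: R_def v_def m)
    moreover have "\<forall>a. c a \<le> c a + c' a" "\<forall>a. c' a \<le> c a + c' a"
      by auto
    ultimately show "n \<in> ?B \<and> n' \<in> ?B"
      using c(2) c'(2) by blast
  qed
  then show ?thesis
    using finR fin by (rule_tac finite_subset) auto
qed

end

typedef 'a formal_sum = "UNIV :: ('a \<Rightarrow> int) set"
  morphisms fcoeff Formal_Sum
  by simp

lemma fcoeff_Formal_Sum [simp]: "fcoeff (Formal_Sum a) = a"
  by (simp add: Formal_Sum_inverse)

lemma formal_sum_eqI: "(\<And>m. fcoeff f m = fcoeff g m) \<Longrightarrow> f = g"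
  by (metis ext fcoeff_inject)

instantiation formal_sum :: (fg_positive_cancelative_semigroup) comm_ring_1
begin

definition zero_formal_sum :: "'a formal_sum" where
  "0 = Formal_Sum (\<lambda>m. 0)"

definition one_formal_sum :: "'a formal_sum" where
  "1 = Formal_Sum (\<lambda>m. if m = 0 then 1 else 0)"

definition plus_formal_sum :: "'a formal_sum \<Rightarrow> 'a formal_sum \<Rightarrow> 'a formal_sum" where
  "f + g = Formal_Sum (\<lambda>m. fcoeff f m + fcoeff g m)"

definition uminus_formal_sum :: "'a formal_sum \<Rightarrow> 'a formal_sum" where
  "- f = Formal_Sum (\<lambda>m. - fcoeff f m)"

definition minus_formal_sum :: "'a formal_sum \<Rightarrow> 'a formal_sum \<Rightarrow> 'a formal_sum" where
  "f - g = Formal_Sum (\<lambda>m. fcoeff f m - fcoeff g m)"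

definition times_formal_sum :: "'a formal_sum \<Rightarrow> 'a formal_sum \<Rightarrow> 'a formal_sum" where
  "f * g = Formal_Sum (\<lambda>m. \<Sum>(n, n') \<in> {(n, n'). n + n' = m}. fcoeff f n * fcoeff g n')"

instance
proof
  fix f g h :: "'a formal_sum"
  show "f * g * h = f * (g * h)"
  proof (rule formal_sum_eqI)
    fix m :: 'a
    let ?D = "\<lambda>m. {(n, n'). n + n' = (m::'a)}"
    let ?t = "\<lambda>(a, b, c). fcoeff f a * fcoeff g b * fcoeff h c"
    let ?T = "{(a, b, c). a + b + c = m}"
    have "fcoeff (f * g * h) m =
        (\<Sum>(k, c)\<in>?D m. \<Sum>(a, b)\<in>?D k. fcoeff f a * fcoeff g b * fcoeff h c)"
      by (simp add: times_formal_sum_def sum_distrib_right case_prod_unfold)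
    also have "\<dots> = (\<Sum>(x, y)\<in>Sigma (?D m) (\<lambda>x. ?D (fst x)).
        fcoeff f (fst y) * fcoeff g (snd y) * fcoeff h (snd x))"
      by (subst sum.Sigma[symmetric])
        (auto simp: case_prod_unfold finite_decompositions[unfolded case_prod_unfold])
    also have "\<dots> = sum ?t ?T"
      by (rule sum.reindex_bij_witness
          [where i = "\<lambda>(a, b, c). ((a + b, c), (a, b))" and j = "\<lambda>(x, y). (fst y, snd y, snd x)"])
        auto
    finally have 1: "fcoeff (f * g * h) m = sum ?t ?T" .
    have "fcoeff (f * (g * h)) m =
        (\<Sum>(a, k)\<in>?D m. \<Sum>(b, c)\<in>?D k. fcoeff f a * fcoeff g b * fcoeff h c)"
      by (simp add: times_formal_sum_def sum_distrib_left case_prod_unfold mult.assoc)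
    also have "\<dots> = (\<Sum>(x, y)\<in>Sigma (?D m) (\<lambda>x. ?D (snd x)).
        fcoeff f (fst x) * fcoeff g (fst y) * fcoeff h (snd y))"
      by (subst sum.Sigma[symmetric])
        (auto simp: case_prod_unfold finite_decompositions[unfolded case_prod_unfold])
    also have "\<dots> = sum ?t ?T"
      by (rule sum.reindex_bij_witness
          [where i = "\<lambda>(a, b, c). ((a, b + c), (b, c))" and j = "\<lambda>(x, y). (fst x, fst y, snd y)"])
        (auto simp: add.assoc)
    finally show "fcoeff (f * g * h) m = fcoeff (f * (g * h)) m"
      using 1 by simp
  qed
  show "f * g = g * f"
  proof (rule formal_sum_eqI)
    fix m :: 'a
    show "fcoeff (f * g) m = fcoeff (g * f) m"
      unfolding times_formal_sum_def fcoeff_Formal_Sum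
      by (rule sum.reindex_bij_witness[where i = prod.swap and j = prod.swap])
        (auto simp: ac_simps)
  qed
  show "1 * f = f"
  proof (rule formal_sum_eqI)
    fix m :: 'a
    have "fcoeff (1 * f) m =
        (\<Sum>x\<in>{(n, n'). n + n' = m}. if x = (0, m) then fcoeff f m else 0)"
      unfolding times_formal_sum_def one_formal_sum_def fcoeff_Formal_Sum
    proof (rule sum.cong[OF refl], simp only: mem_Collect_eq split_paired_all case_prod_conv)
      fix n n' assume "n + n' = m"
      then show "(if n = 0 then 1 else 0) * fcoeff f n' = (if (n, n') = (0, m) then fcoeff f m else 0)"
        by (cases "n = 0") simp_all
    qed
    also have "\<dots> = fcoeff f m"
      by (simp add: finite_decompositions)
    finally show "fcoeff (1 * f) m = fcoeff f m" .
  qed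
  show "(f + g) * h = f * h + g * h"
    by (rule formal_sum_eqI)
      (simp add: times_formal_sum_def plus_formal_sum_def case_prod_unfold distrib_right sum.distrib)
  show "(0 :: 'a formal_sum) \<noteq> 1"
  proof
    assume "(0 :: 'a formal_sum) = 1"
    then have "fcoeff (0 :: 'a formal_sum) 0 = fcoeff 1 0" by simp
    then show False by (simp add: zero_formal_sum_def one_formal_sum_def)
  qed
  show "f + g + h = f + (g + h)"
    by (simp add: plus_formal_sum_def ac_simps)
  show "f + g = g + f"
    by (simp add: plus_formal_sum_def ac_simps)
  show "0 + f = f"
    by (rule formal_sum_eqI) (simp add: plus_formal_sum_def zero_formal_sum_def)
  show "- f + f = 0"
    by (simp add: plus_formal_sum_def uminus_formal_sum_def zero_formal_sum_def)
  show "f - g = f + - g"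
    by (simp add: plus_formal_sum_def uminus_formal_sum_def minus_formal_sum_def)
qed

end

text \<open>The semigroup ring of \<open>S\<close> is the library type \<^typ>\<open>'a \<Rightarrow>\<^sub>0 int\<close>, where \<open>t^m\<close> is
  \<^term>\<open>Poly_Mapping.single m 1\<close>; it is regarded as a subring of the ring of formal sums through
  the following embedding.\<close>

definition to_formal :: "('a \<Rightarrow>\<^sub>0 int) \<Rightarrow> 'a formal_sum" where
  "to_formal r = Formal_Sum (Poly_Mapping.lookup r)"

lemma inj_to_formal: "inj to_formal"
  by (rule injI) (metis fcoeff_Formal_Sum poly_mapping_eqI to_formal_def)

lemma to_formal_one:
  "to_formal (1 :: 'a::fg_positive_cancelative_semigroup \<Rightarrow>\<^sub>0 int) = 1"
  by (rule formal_sum_eqI) (simp add: to_formal_def one_formal_sum_def lookup_one when_def)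

lemma to_formal_diff:
  "to_formal (r - s :: 'a::fg_positive_cancelative_semigroup \<Rightarrow>\<^sub>0 int) = to_formal r - to_formal s"
  by (rule formal_sum_eqI) (simp add: to_formal_def minus_formal_sum_def lookup_minus)

lemma to_formal_mult:
  "to_formal (r * s :: 'a::fg_positive_cancelative_semigroup \<Rightarrow>\<^sub>0 int) = to_formal r * to_formal s"
proof -
  have mono: "to_formal (frag_of a * frag_of b) = to_formal (frag_of a) * to_formal (frag_of b)"
    for a b :: 'a
  proof (rule formal_sum_eqI)
    fix m :: 'a
    have "fcoeff (to_formal (frag_of a) * to_formal (frag_of b)) m =
        (\<Sum>x\<in>{(n, n'). n + n' = m}. if x = (a, b) then 1 else 0)"
      unfolding times_formal_sum_def fcoeff_Formal_Sum to_formal_def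
      by (rule sum.cong[OF refl], simp only: split_paired_all case_prod_conv)
        (simp add: lookup_single when_def)
    also have "\<dots> = (if a + b = m then 1 else 0)"
      by (simp add: finite_decompositions)
    finally show "fcoeff (to_formal (frag_of a * frag_of b)) m =
        fcoeff (to_formal (frag_of a) * to_formal (frag_of b)) m"
      by (simp add: to_formal_def mult_single lookup_single when_def)
  qed
  have zero: "to_formal (0 :: 'a \<Rightarrow>\<^sub>0 int) = 0"
    using to_formal_diff[of 0 0] by simp
  have left: "to_formal (frag_of a * s) = to_formal (frag_of a) * to_formal s" for a
    using subset_UNIV[of "Poly_Mapping.keys s"]
    by (induction s rule: frag_induction)
      (simp_all add: mono zero to_formal_diff right_diff_distrib)
  show ?thesis
    using subset_UNIV[of "Poly_Mapping.keys r"]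
    by (induction r rule: frag_induction)
      (simp_all add: left zero to_formal_diff left_diff_distrib)
qed

definition gen_sum :: "'a set \<Rightarrow> 'a formal_sum" where
  "gen_sum B = Formal_Sum (\<lambda>m. if m \<in> B then 1 else 0)"

text \<open>Meaningful only for units \<open>u\<close>; a fraction \<open>f / u\<close> is \<open>f * unit_inverse u\<close>.\<close>

definition unit_inverse :: "'r::comm_ring_1 \<Rightarrow> 'r" where
  "unit_inverse u = (THE v. u * v = 1)"

lemma unit_inverse:
  assumes "u dvd (1 :: 'r::comm_ring_1)"
  shows "u * unit_inverse u = 1"
proof -
  obtain v where v: "u * v = 1"
    using assms by (metis dvdE)
  have "w = v" if "u * w = 1" for w
  proof -
    have "w = (u * v) * w" using v by simp
    also have "\<dots> = (u * w) * v" by (simp only: ac_simps)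
    finally show ?thesis using that by simp
  qed
  with v show ?thesis
    unfolding unit_inverse_def by (rule theI)
qed


section \<open>Combinatorial data attached to a finite subset\<close>

definition T_complex :: "'a::cancelative_semigroup set \<Rightarrow> 'a \<Rightarrow> 'a set set" where
  "T_complex E m = {J. J \<subseteq> E \<and> of_semigroup m - of_semigroup (\<Sum>J) \<in> range of_semigroup}"

text \<open>The sign is \<open>(-1)^(#J - 1)\<close>, written with exponent \<open>#J + 1\<close> since subtraction of natural
  numbers truncates; the empty face contributes \<open>-1\<close>.\<close>

definition reduced_euler_char :: "'b set set \<Rightarrow> int" where
  "reduced_euler_char T = (\<Sum>J\<in>T. (-1) ^ (card J + 1))"

definition supp :: "'a::cancelative_semigroup set \<Rightarrow> 'a \<Rightarrow> 'a set" where
  "supp E m = {e \<in> E. of_semigroup m - of_semigroup e \<in> range of_semigroup}"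

definition Q_set :: "'a::cancelative_semigroup set \<Rightarrow> 'a set" where
  "Q_set E = {m. \<forall>e\<in>E. of_semigroup m - of_semigroup e \<notin> range of_semigroup}"

definition D_set :: "'a::cancelative_semigroup set \<Rightarrow> 'a set \<Rightarrow> 'a set" where
  "D_set E J =
     {m. J \<subseteq> supp E m \<and> of_semigroup m - of_semigroup (\<Sum>J) \<notin> range of_semigroup}"

end

theory Submission
  imports Defs
begin

text \<open>Expanding \<open>q = \<Sum>\<^sub>J (-1)^#J t^e\<^sub>J\<close>, the coefficient of \<open>q P\<close> at \<open>m\<close> is the sum of
  \<open>(-1)^#J\<close> over \<open>T\<^sub>m\<close>, which gives (1); comparing with the full simplex on \<open>supp(m)\<close>, whose
  alternating sum vanishes unless \<open>m \<in> Q\<close>, gives (2).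

  For (3), every generator of \<open>S\<close> has a positive multiple divisible by some \<open>e \<in> E\<close>, so \<open>Q\<close> is
  finite.  If infinitely many coefficients of \<open>q P\<close> were nonzero, infinitely many of them would
  share one complex \<open>T\<close>; by Dickson's lemma some \<open>m\<close> among these has infinitely many differences
  \<open>d\<close> with \<open>m + d\<close> also among them, and one such \<open>d\<close> lies outside \<open>Q\<close>, hence is divisible by some
  \<open>e \<in> E\<close>.  Then \<open>T\<close> is a cone with apex \<open>e\<close>, and its reduced Euler characteristic vanishes.\<close>

section \<open>Divisibility in the semigroup\<close>

lemma sum_lessThan_const_add:
  fixes g :: "'g::comm_monoid_add"
  shows "(\<Sum>i<k + l. g) = (\<Sum>i<k. g) + (\<Sum>i<l::nat. g)"
  by (induction l) (simp_all add: ac_simps)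

text \<open>Injectivity of \<open>of_semigroup\<close> pulls an equation between differences back to
  the semigroup, so every membership condition below becomes divisibility in the semigroup
  itself.\<close>

lemma diff_in_range_iff:
  fixes m n :: "'a::cancelative_semigroup"
  shows "of_semigroup m - of_semigroup n \<in> range of_semigroup \<longleftrightarrow> (\<exists>k. m = n + k)"
proof -
  have "of_semigroup m - of_semigroup n = of_semigroup k \<longleftrightarrow> m = n + k" for k
    using inj_of_semigroup
    by (auto simp: diff_eq_eq add.commute[of _ n] simp flip: of_semigroup_add dest: injD)
  then show ?thesis
    unfolding image_def by blast
qed

lemma add_left_eq_iff:
  fixes m n k :: "'a::cancelative_semigroup"
  shows "m + n = m + k \<longleftrightarrow> n = k"
  by (metis add.commute cancelative)

section \<open>The complexes \<open>T_complex E m\<close> and their supports\<close>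

lemma T_complex_iff:
  "J \<in> T_complex E m \<longleftrightarrow> J \<subseteq> E \<and> (\<exists>k. m = \<Sum>J + k)"
  by (simp add: T_complex_def diff_in_range_iff)

lemma supp_iff: "e \<in> supp E m \<longleftrightarrow> e \<in> E \<and> (\<exists>k. m = e + k)"
  by (simp add: supp_def diff_in_range_iff)

lemma Q_set_iff: "m \<in> Q_set E \<longleftrightarrow> supp E m = {}"
  by (auto simp: Q_set_def supp_def)

lemma T_complex_subset:
  assumes "finite E" and J: "J \<in> T_complex E m" and K: "K \<subseteq> J"
  shows "K \<in> T_complex E m"
proof -
  obtain k where k: "J \<subseteq> E" "m = \<Sum>J + k"
    using J by (auto simp: T_complex_iff)
  have "finite J"
    using k(1) assms(1) by (rule finite_subset)
  then have "m = \<Sum>K + (\<Sum>(J - K) + k)"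
    using k(2) K by (simp add: sum.subset_diff[of K J] ac_simps)
  then show ?thesis
    using k(1) K by (auto simp: T_complex_iff)
qed

lemma T_complex_subset_supp:
  assumes "finite E" and "J \<in> T_complex E m"
  shows "J \<subseteq> supp E m"
proof
  fix e assume "e \<in> J"
  then have "{e} \<in> T_complex E m"
    using T_complex_subset[OF assms] by simp
  then show "e \<in> supp E m"
    by (simp add: T_complex_iff supp_iff)
qed

text \<open>The faces without \<open>e\<close> are paired with those containing it by
  \<open>J \<mapsto> insert e J\<close>; the two faces of a pair have opposite signs and
  cancel.\<close>

lemma reduced_euler_char_cone:
  assumes "finite T"
    and insert: "\<And>J. J \<in> T \<Longrightarrow> insert e J \<in> T"
    and remove: "\<And>J. J \<in> T \<Longrightarrow> J - {e} \<in> T"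
    and fin: "\<And>J. J \<in> T \<Longrightarrow> finite J"
  shows "reduced_euler_char T = 0"
proof -
  define A where "A = {J \<in> T. e \<notin> J}"
  have "finite A" "A \<inter> insert e ` A = {}"
    using assms(1) by (auto simp: A_def)
  moreover have "T = A \<union> insert e ` A"
  proof
    have "J \<in> insert e ` A" if "J \<in> T" "e \<in> J" for J
      using that remove[OF that(1)] by (intro image_eqI[of _ _ "J - {e}"]) (auto simp: A_def)
    then show "T \<subseteq> A \<union> insert e ` A" by (auto simp: A_def)
    show "A \<union> insert e ` A \<subseteq> T" using insert by (auto simp: A_def)
  qed
  moreover have "inj_on (insert e) A"
    by (rule inj_onI) (auto simp: A_def)
  ultimately have "reduced_euler_char T =
      (\<Sum>J\<in>A. (-1) ^ (card J + 1)) + (\<Sum>J\<in>A. (-1) ^ (card (insert e J) + 1))"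
    unfolding reduced_euler_char_def by (simp add: sum.union_disjoint sum.reindex)
  also have "\<dots> = (\<Sum>J\<in>A. (-1) ^ (card J + 1) + (-1) ^ (card (insert e J) + 1))"
    by (simp only: sum.distrib)
  also have "\<dots> = 0"
    using fin by (intro sum.neutral) (auto simp: A_def)
  finally show ?thesis .
qed

text \<open>If \<open>\<Sum>J\<close> divides \<open>m\<close> and \<open>e\<close> divides
  \<open>d\<close>, then \<open>\<Sum>J + e\<close> divides \<open>m + d\<close>; as both complexes
  agree, adjoining \<open>e\<close> to a face of \<open>T_complex E m\<close> yields a face
  again.\<close>

lemma reduced_euler_char_eq_0:
  assumes E: "finite E" and e: "e \<in> supp E d" and eq: "T_complex E (m + d) = T_complex E m"
  shows "reduced_euler_char (T_complex E m) = 0"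
proof (rule reduced_euler_char_cone[where e = e])
  show "finite (T_complex E m)"
    by (rule finite_subset[of _ "Pow E"]) (auto simp: T_complex_iff E)
  fix J assume J: "J \<in> T_complex E m"
  then show "finite J"
    using finite_subset[OF _ E] by (auto simp: T_complex_iff)
  show "J - {e} \<in> T_complex E m"
    using T_complex_subset[OF E J] by blast
  show "insert e J \<in> T_complex E m"
  proof (cases "e \<in> J")
    case True
    then show ?thesis using J by (simp add: insert_absorb)
  next
    case False
    obtain k where "m = \<Sum>J + k" "J \<subseteq> E"
      using J by (auto simp: T_complex_iff)
    moreover obtain l where "d = e + l" "e \<in> E"
      using e by (auto simp: supp_iff)
    ultimately have "m + d = \<Sum>(insert e J) + (k + l)"
      using False \<open>finite J\<close> by (simp add: ac_simps)
    then show ?thesis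
      unfolding eq[symmetric] using \<open>J \<subseteq> E\<close> \<open>e \<in> E\<close> by (auto simp: T_complex_iff)
  qed
qed

section \<open>Finiteness\<close>

text \<open>Dickson's lemma: a sequence of distinct elements of \<open>X\<close> has a subsequence
  whose coefficient vectors increase in every coordinate, so its first term divides all others, and
  distinct terms have distinct differences.\<close>

lemma infinite_differences:
  fixes X :: "'a::fg_positive_cancelative_semigroup set"
  assumes "infinite X"
  obtains m where "m \<in> X" "infinite {d. m + d \<in> X}"
proof -
  obtain A where A: "finite A" "\<And>m :: 'a. \<exists>c :: 'a \<Rightarrow> nat. m = (\<Sum>a\<in>A. \<Sum>i<c a. a)"
    using finitely_generated by blast
  then obtain c :: "'a \<Rightarrow> 'a \<Rightarrow> nat" where c: "\<And>m. m = (\<Sum>a\<in>A. \<Sum>i<c m a. a)"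
    by metis
  obtain f :: "nat \<Rightarrow> 'a" where f: "inj f" "range f \<subseteq> X"
    using assms infinite_countable_subset by blast
  obtain r :: "nat \<Rightarrow> nat" where r: "strict_mono r" "\<forall>a\<in>A. mono (\<lambda>i. c (f (r i)) a)"
    using mono_subseq_pointwise[OF A(1), of "\<lambda>i. c (f i)"] by blast
  have "\<exists>d. f (r i) = f (r 0) + d" for i
  proof -
    have "f (r i) = (\<Sum>a\<in>A. \<Sum>j<c (f (r i)) a. a)"
      by (rule c)
    also have "\<dots> = (\<Sum>a\<in>A. \<Sum>j<c (f (r 0)) a + (c (f (r i)) a - c (f (r 0)) a). a)"
      using r(2) by (intro sum.cong) (auto simp: mono_def)
    also have "\<dots> = f (r 0) + (\<Sum>a\<in>A. \<Sum>j<c (f (r i)) a - c (f (r 0)) a. a)"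
      by (subst nat_combination_add) (simp flip: c)
    finally show ?thesis by blast
  qed
  then obtain d where d: "\<And>i. f (r i) = f (r 0) + d i"
    by metis
  have "inj d"
    by (rule injI) (metis d f(1) r(1) injD strict_mono_eq)
  moreover have "range d \<subseteq> {d. f (r 0) + d \<in> X}"
    using f(2) by (auto simp flip: d)
  ultimately have "infinite {d. f (r 0) + d \<in> X}"
    using infinite_iff_countable_subset by blast
  with f(2) show thesis by (intro that) auto
qed

text \<open>A finite \<open>E\<close> carries only finitely many complexes, so it suffices that each
  fibre \<open>X T\<close> is finite.\<close>

lemma finite_nonzero_euler_char:
  fixes E :: "'a::fg_positive_cancelative_semigroup set"
  assumes "finite E" and "finite (Q_set E)"
  shows "finite {m. reduced_euler_char (T_complex E m) \<noteq> 0}"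
proof -
  define X where "X T = {m. T_complex E m = T \<and> reduced_euler_char T \<noteq> 0}" for T
  have "finite (X T)" for T
  proof (rule ccontr)
    assume "infinite (X T)"
    then obtain m where m: "m \<in> X T" "infinite {d. m + d \<in> X T}"
      by (rule infinite_differences)
    then have "\<not> {d. m + d \<in> X T} \<subseteq> Q_set E"
      using assms(2) by (meson finite_subset)
    then obtain d where d: "m + d \<in> X T" "d \<notin> Q_set E"
      by blast
    then obtain e where "e \<in> supp E d"
      by (auto simp: Q_set_iff)
    then have "reduced_euler_char (T_complex E m) = 0"
      using m(1) d(1) by (intro reduced_euler_char_eq_0[OF assms(1)]) (auto simp: X_def)
    then show False
      using m(1) by (auto simp: X_def)
  qed
  moreover have "{m. reduced_euler_char (T_complex E m) \<noteq> 0} \<subseteq> (\<Union>T\<in>Pow (Pow E). X T)"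
  proof
    fix m assume "m \<in> {m. reduced_euler_char (T_complex E m) \<noteq> 0}"
    then have "m \<in> X (T_complex E m)" by (simp add: X_def)
    moreover have "T_complex E m \<in> Pow (Pow E)" by (auto simp: T_complex_def)
    ultimately show "m \<in> (\<Union>T\<in>Pow (Pow E). X T)" by blast
  qed
  ultimately show ?thesis
    using assms(1) by (meson finite_Pow_iff finite_UN finite_subset)
qed

text \<open>If a nonzero generator \<open>a\<close> occurred at least \<open>N a\<close> times in
  \<open>m\<close>, an element of \<open>E\<close> dividing that multiple of \<open>a\<close> would
  divide \<open>m\<close>. Elements of \<open>Q_set E\<close> thus have bounded
  coefficients.\<close>

lemma finite_Q_set:
  fixes E :: "'a::fg_positive_cancelative_semigroup set"
  assumes supp: "\<And>a. a \<noteq> 0 \<Longrightarrow> \<exists>n :: nat. supp E (\<Sum>i<n. a) \<noteq> {}"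
  shows "finite (Q_set E)"
proof -
  obtain A where A: "finite A" "\<And>m :: 'a. \<exists>c :: 'a \<Rightarrow> nat. m = (\<Sum>a\<in>A. \<Sum>i<c a. a)"
    using finitely_generated by blast
  obtain N :: "'a \<Rightarrow> nat" where N: "\<And>a. a \<noteq> 0 \<Longrightarrow> supp E (\<Sum>i<N a. a) \<noteq> {}"
    using supp by metis
  let ?C = "{c. \<forall>a. (a \<in> A \<longrightarrow> c a \<in> {..Max (N ` A)}) \<and> (a \<notin> A \<longrightarrow> c a = 0)}"
  have "m \<in> (\<lambda>c. \<Sum>a\<in>A. \<Sum>i<c a. a) ` ?C" if m: "m \<in> Q_set E" for m
  proof -
    from A(2) obtain c :: "'a \<Rightarrow> nat" where c: "m = (\<Sum>a\<in>A. \<Sum>i<c a. a)" ..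
    have lt: "c a < N a" if a: "a \<in> A" "a \<noteq> 0" for a
    proof (rule ccontr)
      assume "\<not> c a < N a"
      then have "c a = N a + (c a - N a)" by simp
      then have "(\<Sum>i<c a. a) = (\<Sum>i<N a. a) + (\<Sum>i<c a - N a. a)"
        by (metis sum_lessThan_const_add)
      moreover have "m = (\<Sum>i<c a. a) + (\<Sum>b\<in>A - {a}. \<Sum>i<c b. b)"
        unfolding c using A(1) a(1) by (rule sum.remove)
      moreover obtain e l where "e \<in> E" "(\<Sum>i<N a. a) = e + l"
        using N[OF a(2)] by (metis ex_in_conv supp_iff)
      ultimately have "m = e + (l + (\<Sum>i<c a - N a. a) + (\<Sum>b\<in>A - {a}. \<Sum>i<c b. b))"
        by (simp add: add.assoc)
      then have "e \<in> supp E m"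
        using \<open>e \<in> E\<close> unfolding supp_iff by blast
      then show False
        using m by (auto simp: Q_set_iff)
    qed
    \<comment> \<open>The generating set may contain 0, whose coefficient has no bound; setting it
      to 0 leaves the sum unchanged.\<close>
    define c' where "c' a = (if a \<in> A \<and> a \<noteq> 0 then c a else 0)" for a
    have "m = (\<Sum>a\<in>A. \<Sum>i<c' a. a)"
      unfolding c by (rule sum.cong) (auto simp: c'_def)
    moreover have "c' a \<le> Max (N ` A)" if "a \<in> A" for a
    proof -
      have "c' a \<le> N a" using lt that by (force simp: c'_def)
      also have "\<dots> \<le> Max (N ` A)" using A(1) that by simp
      finally show ?thesis .
    qed
    ultimately show ?thesis
      by (intro image_eqI[of _ _ c']) (auto simp: c'_def)
  qed
  moreover have "finite ?C"
    using A(1) by (intro finite_set_of_finite_funs) auto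
  ultimately show ?thesis
    by (meson finite_imageI finite_subset subsetI)
qed

section \<open>Clearing denominators in tensor products with the rationals\<close>

text \<open>The action of the integers on an abelian group: \<open>nat\<close> sends negative
  numbers to 0, so at most one of the two sums is nonempty.\<close>

definition int_scale :: "int \<Rightarrow> 'g::ab_group_add \<Rightarrow> 'g" where
  "int_scale k g = (\<Sum>i<nat k. g) - (\<Sum>i<nat (- k). g)"

lemma int_scale_diff_nat: "int_scale (int k - int l) g = (\<Sum>i<k. g) - (\<Sum>i<l. g)"
proof (cases "l \<le> k")
  case True
  then show ?thesis
    using sum_lessThan_const_add[where k = "k - l" and l = l and g = g]
    by (simp add: int_scale_def flip: of_nat_diff)
next
  case False
  then show ?thesis
    using sum_lessThan_const_add[where k = "l - k" and l = k and g = g]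
    by (simp add: int_scale_def flip: of_nat_diff)
qed

lemma int_scale_add_left: "int_scale (j + k) g = int_scale j g + int_scale k g"
proof -
  obtain a b c d where "j = int a - int b" "k = int c - int d"
    by (metis int_diff_cases)
  then have "j + k = int (a + c) - int (b + d)" by simp
  then show ?thesis
    unfolding \<open>j = _\<close> \<open>k = _\<close>
    by (simp only: int_scale_diff_nat sum_lessThan_const_add) (simp add: algebra_simps)
qed

lemma int_scale_add_right: "int_scale k (g + h) = int_scale k g + int_scale k h"
  by (simp add: int_scale_def sum.distrib)

lemma int_scale_0 [simp]: "int_scale 0 g = 0"
  by (simp add: int_scale_def)

lemma int_scale_diff_left: "int_scale (j - k) g = int_scale j g - int_scale k g"
  using int_scale_add_left[of "j - k" k g] by simp

lemma int_scale_nonneg: "0 \<le> k \<Longrightarrow> int_scale k g = (\<Sum>i<nat k. g)"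
  by (simp add: int_scale_def)

text \<open>On formal combinations all of whose second components become integral after multiplication
  by \<open>M\<close>, this represents the map \<open>g \<otimes> r \<mapsto> (M r) g\<close>; the floor makes it total.\<close>

definition clear_denominators :: "int \<Rightarrow> ('g::ab_group_add \<times> rat \<Rightarrow>\<^sub>0 int) \<Rightarrow> 'g" where
  "clear_denominators M x =
     (\<Sum>p\<in>Poly_Mapping.keys x. int_scale (Poly_Mapping.lookup x p * \<lfloor>of_int M * snd p\<rfloor>) (fst p))"

lemma clear_denominators_superset:
  assumes "finite K" "Poly_Mapping.keys x \<subseteq> K"
  shows "clear_denominators M x =
    (\<Sum>p\<in>K. int_scale (Poly_Mapping.lookup x p * \<lfloor>of_int M * snd p\<rfloor>) (fst p))"
  unfolding clear_denominators_def
  using assms by (intro sum.mono_neutral_left) (auto simp: in_keys_iff)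

lemma clear_denominators_0 [simp]: "clear_denominators M 0 = 0"
  by (simp add: clear_denominators_def)

lemma clear_denominators_frag_of [simp]:
  "clear_denominators M (frag_of (g, r)) = int_scale \<lfloor>of_int M * r\<rfloor> g"
  by (simp add: clear_denominators_def)

lemma clear_denominators_diff:
  "clear_denominators M (x - y) = clear_denominators M x - clear_denominators M y"
proof -
  let ?K = "Poly_Mapping.keys x \<union> Poly_Mapping.keys y"
  have "Poly_Mapping.keys (x - y) \<subseteq> ?K"
    by (auto simp: in_keys_iff lookup_minus)
  then show ?thesis
    by (simp add: clear_denominators_superset[of ?K] lookup_minus left_diff_distrib
        int_scale_diff_left sum_subtractf)
qed

lemma clear_denominators_sum:
  "clear_denominators M (sum f I) = (\<Sum>i\<in>I. clear_denominators M (f i))"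
proof (induction I rule: infinite_finite_induct)
  case (insert i I)
  \<comment> \<open>The sum is written as an iterated difference so that compatibility with
    differences applies.\<close>
  have "clear_denominators M (f i - (0 - sum f I)) =
      clear_denominators M (f i) + clear_denominators M (sum f I)"
    by (simp only: clear_denominators_diff clear_denominators_0) simp
  then show ?case
    using insert by simp
qed simp_all

text \<open>A relation involves finitely many fractions, and on integers the floor is additive. The
  statement covers all positive multiples of \<open>M\<close> so that bounds for two relations can
  be merged into their product.\<close>

lemma clear_denominators_bilinearity_relations:
  fixes x :: "'g::ab_group_add \<times> rat \<Rightarrow>\<^sub>0 int"
  assumes "x \<in> bilinearity_relations"
  shows "\<exists>M>0. \<forall>k>0. clear_denominators (k * M) x = 0"
  using assms
proof induction
  case zero
  show ?case by (intro exI[of _ 1]) simp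
next
  case (diff x y)
  then obtain M N where M: "M > 0" "\<forall>k>0. clear_denominators (k * M) x = 0"
    and N: "N > 0" "\<forall>k>0. clear_denominators (k * N) y = 0"
    by blast
  have "clear_denominators (k * (M * N)) (x - y) = 0" if "k > 0" for k
    using M(2)[rule_format, of "k * N"] N(2)[rule_format, of "k * M"] M(1) N(1) that
    by (simp add: clear_denominators_diff ac_simps)
  then show ?case
    using M(1) N(1) by (intro exI[of _ "M * N"]) simp
next
  \<comment> \<open>All three terms carry the same floor, so no denominator has to be
    cleared.\<close>
  case (left g g' h)
  show ?case
    by (intro exI[of _ 1]) (simp add: clear_denominators_diff int_scale_add_right)
next
  case (right g h h')
  obtain a b a' b' where h: "h = of_int a / of_int b" "b > 0" and h': "h' = of_int a' / of_int b'" "b' > 0"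
    by (metis Fract_of_int_quotient quotient_of_unique)
  have "\<lfloor>of_int (k * (b * b')) * (h + h')\<rfloor> =
      \<lfloor>of_int (k * (b * b')) * h\<rfloor> + \<lfloor>of_int (k * (b * b')) * h'\<rfloor>" for k
  proof -
    have "of_int (k * (b * b')) * h = of_int (k * b' * a)" "of_int (k * (b * b')) * h' = of_int (k * b * a')"
      using h h' by simp_all
    then show ?thesis
      by (simp only: distrib_left floor_of_int flip: of_int_add)
  qed
  then have "clear_denominators (k * (b * b')) (frag_of (g, h + h') - frag_of (g, h) - frag_of (g, h')) = 0"
    for k
    by (simp only: clear_denominators_diff clear_denominators_frag_of int_scale_add_left) simp
  then show ?case
    using h(2) h'(2) by (intro exI[of _ "b * b'"]) simp
qed

text \<open>Equality of tensors means that a difference of formal combinations is a bilinearity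
  relation, which \<open>clear_denominators M\<close> kills for a suitable \<open>M\<close>. This
  brings the equation back into the group, torsion included.\<close>

lemma pure_tensor_eq_sum:
  fixes g :: "'g::ab_group_add" and h :: "'i \<Rightarrow> 'g" and r :: "'i \<Rightarrow> rat"
  assumes "pure_tensor g 1 = (\<Sum>i\<in>I. pure_tensor (h i) (r i))"
  shows "\<exists>M>0. int_scale M g = (\<Sum>i\<in>I. int_scale \<lfloor>of_int M * r i\<rfloor> (h i))"
proof -
  have sum: "abs_tensor (sum f I) = (\<Sum>i\<in>I. abs_tensor (f i))"
    for f :: "'i \<Rightarrow> 'g \<times> rat \<Rightarrow>\<^sub>0 int"
    by (induction I rule: infinite_finite_induct) (simp_all add: zero_tensor_def flip: plus_tensor.abs_eq)
  have "abs_tensor (frag_of (g, 1)) = abs_tensor (\<Sum>i\<in>I. frag_of (h i, r i))"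
    using assms by (simp add: sum pure_tensor.abs_eq)
  then have "frag_of (g, 1) - (\<Sum>i\<in>I. frag_of (h i, r i)) \<in> bilinearity_relations"
    by (simp add: tensor.abs_eq_iff tensor_rel_def)
  then obtain M where "M > 0"
    "\<forall>k>0. clear_denominators (k * M) (frag_of (g, 1) - (\<Sum>i\<in>I. frag_of (h i, r i))) = 0"
    using clear_denominators_bilinearity_relations by blast
  then have "clear_denominators (1 * M) (frag_of (g, 1) - (\<Sum>i\<in>I. frag_of (h i, r i))) = 0"
    by (metis zero_less_one)
  then show ?thesis
    using \<open>M > 0\<close> by (auto simp: clear_denominators_diff clear_denominators_sum)
qed

section \<open>From the rational cone back to divisibility\<close>

lemma of_semigroup_0 [simp]: "of_semigroup 0 = 0"
  by transfer (simp add: difference_rel_def)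

lemma of_semigroup_sum: "of_semigroup (sum f I) = (\<Sum>i\<in>I. of_semigroup (f i))"
  by (induction I rule: infinite_finite_induct) (simp_all add: of_semigroup_add)

text \<open>Clearing denominators makes some positive multiple of \<open>a\<close> a combination of
  elements of \<open>E\<close> with natural coefficients. By positivity it is nonzero, so some
  element of \<open>E\<close> really occurs in it.\<close>

lemma generates_cone_supp:
  fixes E :: "'a::fg_positive_cancelative_semigroup set"
  assumes "generates_cone E" and "a \<noteq> 0"
  shows "\<exists>n :: nat. supp E (\<Sum>i<n. a) \<noteq> {}"
proof -
  interpret vector_space "scale_rat :: rat \<Rightarrow> ('a generated_group, rat) tensor \<Rightarrow> _"
    by (rule vector_space_scale_rat)
  have "to_cone a \<in> semigroup_cone"
    unfolding semigroup_cone_def rational_cone_def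
    by (rule CollectI, intro exI[of _ "{to_cone a}"] exI[of _ "\<lambda>_. 1"]) simp
  then have "to_cone a \<in> rational_cone (to_cone ` E)"
    using assms(1) by (auto simp: generates_cone_def)
  then obtain F c where F: "finite F" "F \<subseteq> to_cone ` E" "\<forall>x\<in>F. 0 \<le> c x"
      and a: "to_cone a = (\<Sum>x\<in>F. scale_rat (c x) x)"
    by (auto simp: rational_cone_def)
  \<comment> \<open>Cone elements are lifted to \<open>E\<close> by choice, since
    \<open>to_cone\<close> may identify elements that differ by torsion.\<close>
  obtain u where u: "\<And>x. x \<in> F \<Longrightarrow> u x \<in> E \<and> x = to_cone (u x)"
    using F(2) by (metis image_iff subsetD)
  have "to_cone a = (\<Sum>x\<in>F. scale_rat (c x) (to_cone (u x)))"
    unfolding a using u by (intro sum.cong) auto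
  then have "pure_tensor (of_semigroup a) 1 = (\<Sum>x\<in>F. pure_tensor (of_semigroup (u x)) (c x))"
    by (simp add: to_cone_def scale_rat_pure)
  from pure_tensor_eq_sum[OF this] obtain M where M: "M > 0" "int_scale M (of_semigroup a) =
      (\<Sum>x\<in>F. int_scale \<lfloor>of_int M * c x\<rfloor> (of_semigroup (u x)))"
    by blast
  define n where "n x = nat \<lfloor>of_int M * c x\<rfloor>" for x
  have "of_semigroup (\<Sum>i<nat M. a) = of_semigroup (\<Sum>x\<in>F. \<Sum>i<n x. u x)"
    using M F(3) by (simp add: of_semigroup_sum int_scale_nonneg n_def)
  then have eq: "(\<Sum>i<nat M. a) = (\<Sum>x\<in>F. \<Sum>i<n x. u x)"
    using inj_of_semigroup by (rule injD[rotated])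
  have "(\<Sum>i<nat M. a) \<noteq> 0"
    using M(1) \<open>a \<noteq> 0\<close> sum_eq_0_positive[of "{..<nat M}" "\<lambda>_. a"]
    by (metis finite_lessThan lessThan_iff zero_less_nat_eq)
  then obtain x where x: "x \<in> F" "(\<Sum>i<n x. u x) \<noteq> 0"
    unfolding eq by (meson sum.neutral)
  then obtain k where "n x = Suc k"
    by (cases "n x") auto
  then have "(\<Sum>i<nat M. a) = u x + ((\<Sum>i<k. u x) + (\<Sum>y\<in>F - {x}. \<Sum>i<n y. u y))"
    unfolding eq using F(1) x(1) by (simp add: sum.remove ac_simps)
  then have "u x \<in> supp E (\<Sum>i<nat M. a)"
    using u[OF x(1)] unfolding supp_iff by blast
  then show ?thesis by blast
qed

section \<open>Computations with formal sums\<close>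

lemma fcoeff_sum:
  "fcoeff (sum f I :: 'a::fg_positive_cancelative_semigroup formal_sum) m = (\<Sum>i\<in>I. fcoeff (f i) m)"
  by (induction I rule: infinite_finite_induct) (simp_all add: zero_formal_sum_def plus_formal_sum_def)

lemma fcoeff_uminus:
  "fcoeff (- f :: 'a::fg_positive_cancelative_semigroup formal_sum) m = - fcoeff f m"
  by (simp add: uminus_formal_sum_def)

lemma fcoeff_minus:
  "fcoeff (f - g :: 'a::fg_positive_cancelative_semigroup formal_sum) m = fcoeff f m - fcoeff g m"
  by (simp add: minus_formal_sum_def)

lemma fcoeff_gen_sum: "fcoeff (gen_sum B) m = (if m \<in> B then 1 else 0)"
  by (simp add: gen_sum_def)

lemma fcoeff_neg_one_power_mult:
  "fcoeff ((-1) ^ n * f :: 'a::fg_positive_cancelative_semigroup formal_sum) m = (-1) ^ n * fcoeff f m"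
  by (cases "even n") (simp_all add: fcoeff_uminus)

lemma to_formal_prod:
  "to_formal (prod f I :: 'a::fg_positive_cancelative_semigroup \<Rightarrow>\<^sub>0 int) = (\<Prod>i\<in>I. to_formal (f i))"
  by (induction I rule: infinite_finite_induct) (simp_all add: to_formal_one to_formal_mult)

text \<open>By cancellation at most one decomposition of an exponent has first summand
  \<open>n\<close>, so multiplying by \<open>t^n\<close> just translates the exponents.\<close>

lemma to_formal_frag_of_mult_gen_sum:
  fixes n :: "'a::fg_positive_cancelative_semigroup"
  shows "to_formal (frag_of n) * gen_sum B = gen_sum ((+) n ` B)"
proof (rule formal_sum_eqI)
  fix m :: 'a
  let ?D = "{(x, y). x + y = m}"
  have "fcoeff (to_formal (frag_of n) * gen_sum B) m =
      (\<Sum>p\<in>?D. if fst p = n \<and> snd p \<in> B then 1 else 0)"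
    unfolding times_formal_sum_def fcoeff_Formal_Sum to_formal_def
    by (rule sum.cong) (auto simp: fcoeff_gen_sum)
  also have "\<dots> = (if m \<in> (+) n ` B then 1 else 0)"
  proof (cases "m \<in> (+) n ` B")
    case True
    then obtain k where k: "k \<in> B" "m = n + k" by blast
    have "(\<Sum>p\<in>?D. if fst p = n \<and> snd p \<in> B then 1 else 0 :: int) = (\<Sum>p\<in>?D. if p = (n, k) then 1 else 0)"
      using k by (intro sum.cong) (auto simp: add_left_eq_iff)
    then show ?thesis
      using True k by (simp add: finite_decompositions)
  next
    case False
    then show ?thesis by (auto intro!: sum.neutral)
  qed
  finally show "fcoeff (to_formal (frag_of n) * gen_sum B) m = fcoeff (gen_sum ((+) n ` B)) m"
    by (simp add: fcoeff_gen_sum)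
qed

text \<open>The inverse is the geometric series over the set \<open>B\<close> of multiples of
  \<open>e\<close>. The product telescopes because \<open>B\<close> is the disjoint union of
  \<open>{0}\<close> and \<open>e + B\<close>; positivity keeps 0 out of the latter.\<close>

lemma one_minus_dvd_one:
  fixes e :: "'a::fg_positive_cancelative_semigroup"
  assumes "e \<noteq> 0"
  shows "to_formal (1 - frag_of e) dvd 1"
proof -
  define B where "B = range (\<lambda>n::nat. \<Sum>i<n. e)"
  have *: "m \<in> B \<longleftrightarrow> m = 0 \<or> m \<in> (+) e ` B" for m
  proof
    assume "m \<in> B"
    then obtain n :: nat where "m = (\<Sum>i<n. e)" by (auto simp: B_def)
    then show "m = 0 \<or> m \<in> (+) e ` B"
      by (cases n) (auto simp: B_def add.commute)
  next
    assume "m = 0 \<or> m \<in> (+) e ` B"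
    moreover have "0 = (\<Sum>i<0::nat. e)" "e + (\<Sum>i<n. e) = (\<Sum>i<Suc n. e)" for n
      by (simp_all add: add.commute)
    ultimately show "m \<in> B"
      unfolding B_def by blast
  qed
  have 0: "0 \<notin> (+) e ` B"
    using positive[of e] assms by (metis imageE)
  have "to_formal (1 - frag_of e) * gen_sum B = gen_sum B - gen_sum ((+) e ` B)"
    by (simp add: to_formal_diff to_formal_one left_diff_distrib to_formal_frag_of_mult_gen_sum)
  also have "\<dots> = 1"
  proof (rule formal_sum_eqI)
    show "fcoeff (gen_sum B - gen_sum ((+) e ` B)) m = fcoeff 1 m" for m
      using *[of m] 0 by (auto simp: fcoeff_minus fcoeff_gen_sum one_formal_sum_def)
  qed
  finally show ?thesis by (metis dvd_triv_left)
qed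

lemma prod_dvd_one:
  fixes f :: "'i \<Rightarrow> 'r::comm_semiring_1"
  shows "(\<And>i. i \<in> I \<Longrightarrow> f i dvd 1) \<Longrightarrow> prod f I dvd 1"
  using prod_dvd_prod[of I f "\<lambda>_. 1"] by simp

section \<open>The two forms of the numerator\<close>

lemma to_formal_frag_of_sum:
  fixes J :: "'a::fg_positive_cancelative_semigroup set"
  shows "to_formal (frag_of (\<Sum>J)) = (\<Prod>e\<in>J. to_formal (frag_of e))"
proof (induction J rule: infinite_finite_induct)
  case (insert e J)
  have "frag_of (e + \<Sum>J) = frag_of e * frag_of (\<Sum>J)"
    by (simp add: mult_single)
  then show ?case
    using insert by (simp add: to_formal_mult)
qed (simp_all add: to_formal_one)

text \<open>The term of \<open>J\<close> in the expanded product contributes to the coefficient at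
  \<open>m\<close> exactly when \<open>\<Sum>J\<close> divides \<open>m\<close>. The outer minus
  sign absorbs the shifted exponent \<open>card J + 1\<close> in
  \<open>reduced_euler_char\<close>.\<close>

lemma to_formal_prod_mult_gen_sum_UNIV:
  fixes E :: "'a::fg_positive_cancelative_semigroup set"
  assumes "finite E"
  shows "to_formal (\<Prod>e\<in>E. 1 - frag_of e) * gen_sum UNIV =
    - Formal_Sum (\<lambda>m. reduced_euler_char (T_complex E m))"
proof (rule formal_sum_eqI)
  fix m :: 'a
  have "to_formal (\<Prod>e\<in>E. 1 - frag_of e) = (\<Prod>e\<in>E. 1 - to_formal (frag_of e))"
    by (simp add: to_formal_prod to_formal_diff to_formal_one)
  also have "\<dots> = (\<Sum>J\<in>Pow E. (-1) ^ card J * to_formal (frag_of (\<Sum>J)))"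
    by (subst prod_diff_conv_sum[OF assms]) (simp add: to_formal_frag_of_sum)
  finally have "fcoeff (to_formal (\<Prod>e\<in>E. 1 - frag_of e) * gen_sum UNIV) m =
      (\<Sum>J\<in>Pow E. (-1) ^ card J * fcoeff (gen_sum (range ((+) (\<Sum>J)))) m)"
    by (simp only: sum_distrib_right fcoeff_sum mult.assoc fcoeff_neg_one_power_mult
        to_formal_frag_of_mult_gen_sum)
  also have "\<dots> = (\<Sum>J\<in>T_complex E m. (-1) ^ card J)"
    using assms
    by (intro sum.mono_neutral_cong_right) (auto simp: T_complex_iff fcoeff_gen_sum)
  also have "\<dots> = - reduced_euler_char (T_complex E m)"
    by (simp add: reduced_euler_char_def sum_negf)
  finally show "fcoeff (to_formal (\<Prod>e\<in>E. 1 - frag_of e) * gen_sum UNIV) m =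
      fcoeff (- Formal_Sum (\<lambda>m. reduced_euler_char (T_complex E m))) m"
    by (simp add: fcoeff_uminus)
qed

text \<open>This is the expansion of the product of \<open>1 - 1\<close> over
  \<open>A\<close>.\<close>

lemma sum_Pow_neg_one_power:
  assumes "finite A"
  shows "(\<Sum>J\<in>Pow A. (-1) ^ card J :: int) = (if A = {} then 1 else 0)"
  using prod_diff_conv_sum[OF assms, of "\<lambda>_. 1 :: int" "\<lambda>_. 1"] assms by (simp add: power_0_left)

text \<open>\<open>D_set E J\<close> contains \<open>m\<close> exactly when \<open>J\<close> is a
  face of the simplex on \<open>supp E m\<close> missing from \<open>T_complex E m\<close>; the
  alternating sum over the whole simplex is the coefficient of
  \<open>gen_sum (Q_set E)\<close>.\<close>

lemma gen_sum_Q_set_minus: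
  fixes E :: "'a::fg_positive_cancelative_semigroup set"
  assumes "finite E"
  shows "gen_sum (Q_set E) - (\<Sum>J | J \<subseteq> E \<and> 2 \<le> card J. (-1) ^ card J * gen_sum (D_set E J)) =
    - Formal_Sum (\<lambda>m. reduced_euler_char (T_complex E m))"
proof (rule formal_sum_eqI)
  fix m :: 'a
  let ?S = "supp E m" and ?T = "T_complex E m"
  have fin: "finite ?S"
    using assms by (rule finite_subset[rotated]) (auto simp: supp_def)
  have T: "?T \<subseteq> Pow ?S"
    using T_complex_subset_supp[OF assms] by blast
  \<comment> \<open>The empty set and the singletons from \<open>supp E m\<close> always lie in the
    complex, so restricting to \<open>2 \<le> card J\<close> loses no missing face.\<close>
  have small: "2 \<le> card J" if J: "J \<in> Pow ?S - ?T" for J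
  proof (rule ccontr)
    assume "\<not> 2 \<le> card J"
    then have "card J = 0 \<or> card J = 1" by linarith
    moreover have "finite J" using J fin finite_subset by blast
    ultimately have "J = {} \<or> (\<exists>e. J = {e})"
      by (auto simp: card_1_singleton_iff)
    then show False
      using J by (auto simp: T_complex_iff supp_iff)
  qed
  have "(\<Sum>J | J \<subseteq> E \<and> 2 \<le> card J. (-1) ^ card J * fcoeff (gen_sum (D_set E J)) m) =
      (\<Sum>J\<in>Pow ?S - ?T. (-1) ^ card J)"
    using assms small
    by (intro sum.mono_neutral_cong_right)
      (auto simp: fcoeff_gen_sum D_set_def T_complex_def supp_def)
  also have "\<dots> = (\<Sum>J\<in>Pow ?S. (-1) ^ card J) - (\<Sum>J\<in>?T. (-1) ^ card J)"
    using fin T by (simp add: sum_diff)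
  also have "\<dots> = fcoeff (gen_sum (Q_set E)) m + reduced_euler_char ?T"
    using fin by (simp add: sum_Pow_neg_one_power fcoeff_gen_sum Q_set_iff reduced_euler_char_def sum_negf)
  finally show "fcoeff (gen_sum (Q_set E) -
        (\<Sum>J | J \<subseteq> E \<and> 2 \<le> card J. (-1) ^ card J * gen_sum (D_set E J))) m =
      fcoeff (- Formal_Sum (\<lambda>m. reduced_euler_char (T_complex E m))) m"
    by (simp add: fcoeff_minus fcoeff_sum fcoeff_neg_one_power_mult fcoeff_uminus)
qed

lemma in_range_to_formal:
  assumes "finite {m. fcoeff f m \<noteq> 0}"
  shows "f \<in> range to_formal"
proof
  show "f = to_formal (Abs_poly_mapping (fcoeff f))"
    using assms by (simp add: to_formal_def fcoeff_inverse)
qed simp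

theorem theorem2p2:
  fixes E :: "'a::fg_positive_cancelative_semigroup set"
    and q :: "'a \<Rightarrow>\<^sub>0 int"
    and P p :: "'a formal_sum"
  assumes "finite E" and "E \<noteq> {}" and "0 \<notin> E"
    and "P = gen_sum UNIV"
    and "q = (\<Prod>e\<in>E. 1 - Poly_Mapping.single e 1)"
    and "p = to_formal q * P"
  shows "to_formal q dvd 1
    \<and> P = - Formal_Sum (\<lambda>m. reduced_euler_char (T_complex E m)) * unit_inverse (to_formal q)
    \<and> P = (gen_sum (Q_set E)
            - (\<Sum>J | J \<subseteq> E \<and> 2 \<le> card J. (-1) ^ card J * gen_sum (D_set E J)))
          * unit_inverse (to_formal q)
    \<and> (generates_cone E \<longrightarrow> p \<in> range to_formal)
    \<and> (\<forall>q' p' :: 'a \<Rightarrow>\<^sub>0 int. to_formal q' * P = to_formal p'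
          \<longrightarrow> p * to_formal q' = to_formal p' * to_formal q)"
proof -
  have unit: "to_formal q dvd 1"
    unfolding assms(5) to_formal_prod
    using assms(3) by (intro prod_dvd_one one_minus_dvd_one) auto
  have p: "p = - Formal_Sum (\<lambda>m. reduced_euler_char (T_complex E m))"
    unfolding assms(4-6) by (rule to_formal_prod_mult_gen_sum_UNIV[OF assms(1)])
  have P: "P = p * unit_inverse (to_formal q)"
    unfolding assms(6) using unit_inverse[OF unit]
    by (metis mult.assoc mult.commute mult.left_neutral)
  have "p \<in> range to_formal" if "generates_cone E"
  proof (rule in_range_to_formal)
    have "finite (Q_set E)"
      using generates_cone_supp[OF that] by (rule finite_Q_set)
    then show "finite {m. fcoeff p m \<noteq> 0}"
      unfolding p using finite_nonzero_euler_char[OF assms(1)] by (simp add: fcoeff_uminus)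
  qed
  moreover have "p * to_formal q' = to_formal p' * to_formal q"
    if "to_formal q' * P = to_formal p'" for q' p' :: "'a \<Rightarrow>\<^sub>0 int"
    unfolding assms(6) that[symmetric] by (simp only: ac_simps)
  \<comment> \<open>Both numerators equal \<open>p\<close>, so (1) and (2) reduce to the same
    identity \<open>P\<close>.\<close>
  ultimately show ?thesis
    using unit P unfolding gen_sum_Q_set_minus[OF assms(1)] p[symmetric] by blast
qed

end
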